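(* Let $[H,G]$ be a Boolean interval of finite groups. The edge labeling $el$ on $\hat{C}(H,G)$ is a dual EL-labeling if and only if $[H,G]$ is group-complemented.
   Context: An interval of finite groups $[H,G]$ is the lattice of all subgroups $K$ with $H \subseteq K \subseteq G$, where $G$ is a finite group and $H$ a subgroup. It is Boolean if it is isomorphic to the lattice of subsets of a finite set; then each $K \in [H,G]$ has a unique lattice-complement $K^{\complement}$. A Boolean interval is group-complemented if $KK^{\complement} = G$ (as a product set) for every $K \in [H,G]$. The coset poset $C(H,G)$ is the set of all right cosets $Kg$ with $g \in G$ and $K \in [H,G]$, $K \neq G$, ordered by inclusion, and $\hat{C}(H,G) := C(H,G) \sqcup \{\emptyset, G\}$, ordered by inclusion. When $[H,G]$ is Boolean, $\hat{C}(H,G)$ is graded (bounded, with all maximal chains of the same length). Fix an enumeration $K_1,\dots,K_n$ of the atoms of the Boolean lattice $[H,G]$, and let $M_i := K_i^{\complement}$ (the coatoms). Every cover relation of $\hat{C}(H,G)$ is of the form $\emptyset \lessdot Hg$, or $Xg \lessdot Yg$ with $g \in G$, $X, Y \in [H,G]$, $Y = X \vee K_i$ for a (unique) $i$, and $K_i \nsubseteq X$. The edge labeling $el$ assigns an integer to each cover relation by: $el(\emptyset \lessdot Hg) = 0$; and, for $Y = X \vee K_i$ with $K_i \nsubseteq X$, $el(Xg \lessdot Yg) = -i$ if $Xg = Yg \cap M_i$, and $el(Xg \lessdot Yg) = +i$ otherwise. An edge labeling of a graded poset $P$ (a map from the cover relations of $P$ to a poset, here $\mathbb{Z}$) is an EL-labeling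 if for each closed interval $[x,y]$ of $P$ there is a unique maximal chain of $[x,y]$ whose sequence of labels (read from $x$ to $y$) is strictly increasing, and the label sequence of this chain is lexicographically first among those of all the other maximal chains of $[x,y]$. A dual EL-labeling of $P$ is an EL-labeling of the dual (order-reversed) poset, i.e. the labels are read from top to bottom. *)

theory Defs
  imports "HOL-Algebra.Coset"
begin

section \<open>Graded posets and EL-labelings\<close>

definition covers :: "('p, 'c) gorder_scheme \<Rightarrow> 'p \<Rightarrow> 'p \<Rightarrow> bool" where
  "covers P x y \<longleftrightarrow> x \<in> carrier P \<and> y \<in> carrier P \<and> x \<sqsubset>\<^bsub>P\<^esub> y \<and>
     (\<nexists>z. z \<in> carrier P \<and> x \<sqsubset>\<^bsub>P\<^esub> z \<and> z \<sqsubset>\<^bsub>P\<^esub> y)"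

definition graded_poset :: "('p, 'c) gorder_scheme \<Rightarrow> bool" where
  "graded_poset P \<longleftrightarrow> partial_order P \<and>
     (\<exists>b. least P b (carrier P)) \<and> (\<exists>t. greatest P t (carrier P)) \<and>
     (\<exists>r. \<forall>C. pred_on.maxchain (carrier P) (lless P) C \<longrightarrow> finite C \<and> card C = Suc r)"

text \<open>The maximal chains of a closed interval, listed in ascending order.\<close>

definition maximal_chain_between :: "('p, 'c) gorder_scheme \<Rightarrow> 'p \<Rightarrow> 'p \<Rightarrow> 'p list \<Rightarrow> bool" where
  "maximal_chain_between P x y c \<longleftrightarrow> sorted_wrt (lless P) c \<and>
     pred_on.maxchain (at_least_at_most P x y) (lless P) (set c)"

text \<open>
  An edge labeling is a function of the lower and the upper end of a cover relation; its values
  at other pairs never matter, since consecutive elements of a maximal chain cover each other.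
\<close>

definition label_sequence :: "('p \<Rightarrow> 'p \<Rightarrow> 'l) \<Rightarrow> 'p list \<Rightarrow> 'l list" where
  "label_sequence l c = map2 l (butlast c) (tl c)"

definition EL_labeling :: "('p, 'c) gorder_scheme \<Rightarrow> ('p \<Rightarrow> 'p \<Rightarrow> 'l::order) \<Rightarrow> bool" where
  "EL_labeling P l \<longleftrightarrow> graded_poset P \<and>
     (\<forall>x\<in>carrier P. \<forall>y\<in>carrier P. x \<sqsubseteq>\<^bsub>P\<^esub> y \<longrightarrow>
       (\<exists>c. maximal_chain_between P x y c \<and> sorted_wrt (<) (label_sequence l c) \<and>
         (\<forall>d. maximal_chain_between P x y d \<and> d \<noteq> c \<longrightarrow>
            \<not> sorted_wrt (<) (label_sequence l d) \<and>
            (label_sequence l c, label_sequence l d) \<in> lexord {(a, b). a < b})))"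

definition dual_EL_labeling :: "('p, 'c) gorder_scheme \<Rightarrow> ('p \<Rightarrow> 'p \<Rightarrow> 'l::order) \<Rightarrow> bool" where
  "dual_EL_labeling P l \<longleftrightarrow> EL_labeling (inv_gorder P) (\<lambda>x y. l y x)"


section \<open>Boolean intervals of groups\<close>

abbreviation inclusion_order :: "'a set set \<Rightarrow> 'a set gorder" where
  "inclusion_order A \<equiv> \<lparr>carrier = A, eq = (=), le = (\<subseteq>)\<rparr>"

definition order_isomorphic :: "('p, 'c) gorder_scheme \<Rightarrow> ('q, 'd) gorder_scheme \<Rightarrow> bool" where
  "order_isomorphic P Q \<longleftrightarrow> (\<exists>f. bij_betw f (carrier P) (carrier Q) \<and>
     (\<forall>x\<in>carrier P. \<forall>y\<in>carrier P. x \<sqsubseteq>\<^bsub>P\<^esub> y \<longleftrightarrow> f x \<sqsubseteq>\<^bsub>Q\<^esub> f y))"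

definition boolean_lattice :: "('p, 'c) gorder_scheme \<Rightarrow> bool" where
  "boolean_lattice L \<longleftrightarrow> (\<exists>S :: nat set. finite S \<and> order_isomorphic L (inclusion_order (Pow S)))"

text \<open>Complements are unique in a Boolean lattice, so there the description below is proper.\<close>

definition lattice_complement :: "('p, 'c) gorder_scheme \<Rightarrow> 'p \<Rightarrow> 'p" where
  "lattice_complement L x =
     (THE y. y \<in> carrier L \<and> x \<sqinter>\<^bsub>L\<^esub> y = \<bottom>\<^bsub>L\<^esub> \<and> x \<squnion>\<^bsub>L\<^esub> y = \<top>\<^bsub>L\<^esub>)"

definition subgroup_interval :: "('a, 'b) monoid_scheme \<Rightarrow> 'a set \<Rightarrow> 'a set gorder" where
  "subgroup_interval G H = inclusion_order {K. subgroup K G \<and> H \<subseteq> K}"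

definition group_complemented :: "('a, 'b) monoid_scheme \<Rightarrow> 'a set \<Rightarrow> bool" where
  "group_complemented G H \<longleftrightarrow>
     (\<forall>K\<in>carrier (subgroup_interval G H).
        K <#>\<^bsub>G\<^esub> lattice_complement (subgroup_interval G H) K = carrier G)"

definition atoms_of_interval :: "('a, 'b) monoid_scheme \<Rightarrow> 'a set \<Rightarrow> 'a set set" where
  "atoms_of_interval G H = {K. covers (subgroup_interval G H) H K}"


section \<open>The coset poset and its edge labeling\<close>

definition coset_poset :: "('a, 'b) monoid_scheme \<Rightarrow> 'a set \<Rightarrow> 'a set set" where
  "coset_poset G H = {K #>\<^bsub>G\<^esub> g | K g. K \<in> carrier (subgroup_interval G H) \<and>
     K \<noteq> carrier G \<and> g \<in> carrier G}"

definition bounded_coset_poset :: "('a, 'b) monoid_scheme \<Rightarrow> 'a set \<Rightarrow> 'a set gorder" where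
  "bounded_coset_poset G H = inclusion_order (coset_poset G H \<union> {{}, carrier G})"

text \<open>
  For a cover relation \<open>X g \<lessdot> Y g\<close> with \<open>Y = X \<squnion> K i\<close> and \<open>K i \<nsubseteq> X\<close>, the index \<open>i\<close>.
  It only depends on the two cosets, because a right coset determines its subgroup.
\<close>

definition edge_index ::
  "('a, 'b) monoid_scheme \<Rightarrow> 'a set \<Rightarrow> (nat \<Rightarrow> 'a set) \<Rightarrow> nat \<Rightarrow> 'a set \<Rightarrow> 'a set \<Rightarrow> nat" where
  "edge_index G H K n A B = (THE i. i \<in> {1..n} \<and>
     (\<exists>X\<in>carrier (subgroup_interval G H). \<exists>Y\<in>carrier (subgroup_interval G H). \<exists>g\<in>carrier G.
        A = X #>\<^bsub>G\<^esub> g \<and> B = Y #>\<^bsub>G\<^esub> g \<and>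
        Y = X \<squnion>\<^bsub>subgroup_interval G H\<^esub> K i \<and> \<not> K i \<subseteq> X))"

definition el ::
  "('a, 'b) monoid_scheme \<Rightarrow> 'a set \<Rightarrow> (nat \<Rightarrow> 'a set) \<Rightarrow> nat \<Rightarrow> 'a set \<Rightarrow> 'a set \<Rightarrow> int" where
  "el G H K n A B =
     (if A = {} then 0
      else let i = edge_index G H K n A B in
        if A = B \<inter> lattice_complement (subgroup_interval G H) (K i) then - int i else int i)"

end

theory Submission
  imports Defs
begin

text \<open>
  Write \<open>X T\<close> for the element of the interval that is the join of the atoms indexed by \<open>T\<close>.
  The step from \<open>X U g\<close> down to \<open>X (U - {i}) g\<close> is labelled \<open>- i\<close> if \<open>g\<close> lies in the coatom
  \<open>M i\<close> and \<open>i\<close> otherwise, independently of \<open>U\<close>. So between two cosets, maximal chains are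
  orderings of a fixed set of distinct labels, and sorting gives the unique increasing chain, which
  is lexicographically first. A chain from \<open>X T g\<close> to \<open>{}\<close> also chooses a coset \<open>H h \<subseteq> X T g\<close>, and
  as its last label is \<open>0\<close> it can only increase if \<open>h \<in> M i\<close> for all \<open>i \<in> T\<close>, that is, if \<open>h\<close>
  lies in the complement of \<open>X T\<close>. Such an \<open>h\<close> exists for every \<open>g\<close> if and only if \<open>X T\<close> times
  its complement is \<open>G\<close>, and then \<open>H h\<close> is unique.
\<close>

section \<open>Saturated chains and sorted label sequences\<close>

lemma coversD:
  assumes "covers P x y"
  shows "x \<in> carrier P" "y \<in> carrier P" "x \<sqsubset>\<^bsub>P\<^esub> y"
    "z \<in> carrier P \<Longrightarrow> x \<sqsubset>\<^bsub>P\<^esub> z \<Longrightarrow> \<not> z \<sqsubset>\<^bsub>P\<^esub> y"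
  using assms by (auto simp: covers_def)

lemma successively_covers_carrier:
  "successively (covers P) c \<Longrightarrow> hd c \<in> carrier P \<Longrightarrow> set c \<subseteq> carrier P"
  by (induction c rule: induct_list012) (auto dest: coversD)

lemma (in partial_order) successively_covers_imp_sorted:
  "successively (covers L) c \<Longrightarrow> sorted_wrt (\<sqsubset>) c"
proof (induction c rule: induct_list012)
  case (3 x y zs)
  then have xy: "covers L x y" and sorted: "sorted_wrt (\<sqsubset>) (y # zs)" by auto
  have "set (y # zs) \<subseteq> carrier L"
    using 3 coversD(2)[OF xy] by (intro successively_covers_carrier) auto
  with sorted have "x \<sqsubset> w" if "w \<in> set zs" for w
    using that coversD[OF xy] by (auto intro: lless_trans[of x y w])
  then show ?case using sorted coversD(3)[OF xy] by auto
qed auto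

text \<open>Walk along the chain while the next element stays below \<open>z\<close>. Where it first
  fails to, comparability puts \<open>z\<close> strictly below the upper end of a cover, so
  \<open>z\<close> is its lower end. If it never fails, \<open>z\<close> is the last element by
  antisymmetry.\<close>

lemma (in partial_order) comparable_in_saturated_chain:
  assumes "successively (covers L) c" "c \<noteq> []" "z \<in> carrier L" "hd c \<sqsubseteq> z" "z \<sqsubseteq> last c"
    "set c \<subseteq> carrier L" "\<forall>w\<in>set c. w \<sqsubseteq> z \<or> z \<sqsubseteq> w"
  shows "z \<in> set c"
  using assms
proof (induction c rule: induct_list012)
  case (2 x)
  then show ?case by auto
next
  case (3 x y zs)
  show ?case
  proof (cases "y \<sqsubseteq> z")
    case True
    then have "z \<in> set (y # zs)" using 3 by auto
    then show ?thesis by simp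
  next
    case False
    then have "z \<sqsubset> y" "x \<sqsubseteq> z" "covers L x y" using 3 by (auto simp: lless_eq)
    then have "z = x" using coversD(4)[of L x y z] 3 by (auto simp: lless_eq)
    then show ?thesis by simp
  qed
qed auto

lemma sorted_wrt_adjacent_cases:
  assumes "sorted_wrt R (xs @ a # b # ys)" "w \<in> set (xs @ a # b # ys)"
  shows "w = a \<or> w = b \<or> R w a \<or> R b w"
  using assms by (auto simp: sorted_wrt_append)

text \<open>The whole split is kept in the premise so that a global property of the list, such as
  sortedness, can be used at a pair of neighbours.\<close>

lemma successively_from_splits:
  "(\<And>xs a b ys. c = xs @ a # b # ys \<Longrightarrow> P a b) \<Longrightarrow> successively P c"
proof (induction c rule: induct_list012)
  case (3 x y zs)
  have "P x y" using 3(3)[of "[]"] by simp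
  moreover have "successively P (y # zs)"
    using 3(3)[of "x # _"] by (intro 3(2)) auto
  ultimately show ?case by simp
qed auto

text \<open>Trades maximality among sets for a local condition on lists that supports induction. An
  element comparable to the whole of a maximal chain belongs to it; this applies to both ends of the
  interval and excludes elements between neighbours. Conversely,
  \<open>comparable_in_saturated_chain\<close> shows that nothing can be added.\<close>

lemma (in partial_order) maximal_chain_between_iff:
  assumes x: "x \<in> carrier L" and y: "y \<in> carrier L" and xy: "x \<sqsubseteq> y"
  shows "maximal_chain_between L x y c \<longleftrightarrow>
    c \<noteq> [] \<and> hd c = x \<and> last c = y \<and> successively (covers L) c"
proof
  assume "maximal_chain_between L x y c"
  then have sorted: "sorted_wrt (\<sqsubset>) c"
    and chain: "pred_on.chain \<lbrace>x..y\<rbrace> (\<sqsubset>) (set c)"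
    and max: "\<nexists>S. pred_on.chain \<lbrace>x..y\<rbrace> (\<sqsubset>) S \<and> set c \<subset> S"
    by (simp_all add: maximal_chain_between_def pred_on.maxchain_def)
  have sub: "set c \<subseteq> \<lbrace>x..y\<rbrace>"
    and total: "\<forall>a\<in>set c. \<forall>b\<in>set c. a \<sqsubset> b \<or> a = b \<or> b \<sqsubset> a"
    using chain unfolding pred_on.chain_def by auto
  have maxz: "z \<in> set c" if z: "z \<in> \<lbrace>x..y\<rbrace>" and cmp: "\<And>w. w \<in> set c \<Longrightarrow> w = z \<or> w \<sqsubset> z \<or> z \<sqsubset> w" for z
  proof -
    have "pred_on.chain \<lbrace>x..y\<rbrace> (\<sqsubset>) (insert z (set c))"
      unfolding pred_on.chain_def using sub z total cmp by auto
    then show ?thesis using max by blast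
  qed
  have carr: "set c \<subseteq> carrier L" and lo: "\<And>w. w \<in> set c \<Longrightarrow> x \<sqsubseteq> w" and up: "\<And>w. w \<in> set c \<Longrightarrow> w \<sqsubseteq> y"
    using sub by (auto simp: at_least_at_most_def)
  have xc: "x \<in> set c" and yc: "y \<in> set c"
  proof -
    have "x \<in> \<lbrace>x..y\<rbrace>" "y \<in> \<lbrace>x..y\<rbrace>" using x y xy by (auto simp: at_least_at_most_def)
    then show "x \<in> set c" "y \<in> set c"
      using lo up by (metis maxz lless_eq)+
  qed
  have ne: "c \<noteq> []" using xc by auto
  have hd: "hd c = x"
  proof (rule ccontr)
    assume *: "hd c \<noteq> x"
    obtain a c' where "c = a # c'" using ne by (cases c) auto
    with * xc sorted have "a \<sqsubset> x" by auto
    then show False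
      using lo[of a] carr x \<open>c = a # c'\<close> by (auto simp: lless_eq)
  qed
  have last: "last c = y"
  proof (rule ccontr)
    assume *: "last c \<noteq> y"
    obtain a c' where "c = c' @ [a]" using ne by (cases c rule: rev_cases) auto
    with * yc sorted have "y \<sqsubset> a" by (auto simp: sorted_wrt_append)
    then show False
      using up[of a] carr y \<open>c = c' @ [a]\<close> by (auto simp: lless_eq)
  qed
  have "successively (covers L) c"
  proof (rule successively_from_splits)
    fix xs a b ys assume c: "c = xs @ a # b # ys"
    have ab: "a \<in> carrier L" "b \<in> carrier L" "a \<sqsubset> b"
      using c carr sorted by (auto simp: sorted_wrt_append)
    have False if z: "z \<in> carrier L" "a \<sqsubset> z" "z \<sqsubset> b" for z
    proof -
      have "z \<in> set c"
      proof (rule maxz)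
        have "x \<sqsubseteq> a" "b \<sqsubseteq> y" using lo up c by auto
        then show "z \<in> \<lbrace>x..y\<rbrace>"
          using z ab x y by (auto simp: at_least_at_most_def lless_eq intro: le_trans)
        show "w = z \<or> w \<sqsubset> z \<or> z \<sqsubset> w" if "w \<in> set c" for w
          using sorted_wrt_adjacent_cases[OF sorted[unfolded c] that[unfolded c]] z ab that carr
          by (auto intro: lless_trans)
      qed
      from sorted_wrt_adjacent_cases[OF sorted[unfolded c] this[unfolded c]]
      have "z = a \<or> z = b \<or> z \<sqsubset> a \<or> b \<sqsubset> z" .
      then show False
        using z ab by (metis le_antisym lless_eq)
    qed
    then show "covers L a b" using ab by (auto simp: covers_def)
  qed
  with ne hd last show "c \<noteq> [] \<and> hd c = x \<and> last c = y \<and> successively (covers L) c"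
    by blast
next
  assume "c \<noteq> [] \<and> hd c = x \<and> last c = y \<and> successively (covers L) c"
  then have ne: "c \<noteq> []" and hd: "hd c = x" and last: "last c = y"
    and succ: "successively (covers L) c" by auto
  have sorted: "sorted_wrt (\<sqsubset>) c" by (rule successively_covers_imp_sorted[OF succ])
  have carr: "set c \<subseteq> carrier L"
    using succ hd x by (intro successively_covers_carrier) auto
  have lo: "x \<sqsubseteq> w" if "w \<in> set c" for w
    using that sorted hd x by (cases c) (auto simp: lless_eq)
  have up: "w \<sqsubseteq> y" if "w \<in> set c" for w
    using that sorted last y ne by (cases c rule: rev_cases) (auto simp: lless_eq sorted_wrt_append)
  have chain: "pred_on.chain \<lbrace>x..y\<rbrace> (\<sqsubset>) (set c)"
  proof -
    have "a \<sqsubset> b \<or> a = b \<or> b \<sqsubset> a" if "a \<in> set c" "b \<in> set c" for a b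
      using that sorted by (induction c) auto
    then show ?thesis
      unfolding pred_on.chain_def using carr lo up x y by (auto simp: at_least_at_most_def)
  qed
  have "z \<in> set c" if S: "pred_on.chain \<lbrace>x..y\<rbrace> (\<sqsubset>) S" "set c \<subseteq> S" "z \<in> S" for S z
  proof (rule comparable_in_saturated_chain[OF succ ne])
    have z: "z \<in> \<lbrace>x..y\<rbrace>" using S by (auto simp: pred_on.chain_def)
    then show "z \<in> carrier L" "hd c \<sqsubseteq> z" "z \<sqsubseteq> last c"
      by (auto simp: hd last at_least_at_most_def)
    show "set c \<subseteq> carrier L" by (fact carr)
    show "\<forall>w\<in>set c. w \<sqsubseteq> z \<or> z \<sqsubseteq> w"
    proof
      fix w assume "w \<in> set c"
      then have "w \<sqsubset> z \<or> w = z \<or> z \<sqsubset> w"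
        using S unfolding pred_on.chain_def by blast
      then show "w \<sqsubseteq> z \<or> z \<sqsubseteq> w"
        using \<open>z \<in> carrier L\<close> by (auto simp: lless_eq)
    qed
  qed
  then show "maximal_chain_between L x y c"
    using sorted chain by (auto simp: maximal_chain_between_def pred_on.maxchain_def)
qed

text \<open>Removes a least element repeatedly. Gradedness is about chains as sets; the list makes
  the description of maximal chains applicable to them.\<close>

lemma (in partial_order) finite_chain_sorted_list:
  assumes "finite C" "C \<subseteq> carrier L" "\<forall>a\<in>C. \<forall>b\<in>C. a \<sqsubseteq> b \<or> b \<sqsubseteq> a"
  obtains c where "set c = C" "distinct c" "sorted_wrt (\<sqsubset>) c"
proof -
  have "\<exists>c. set c = C \<and> distinct c \<and> sorted_wrt (\<sqsubset>) c"
    using assms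
  proof (induction C rule: finite_psubset_induct)
    case (psubset C)
    show ?case
    proof (cases "C = {}")
      case False
      have "\<exists>m\<in>C. \<forall>a\<in>C. m \<sqsubseteq> a"
        using psubset.hyps False psubset.prems
      proof (induction C rule: finite_ne_induct)
        case (insert b F)
        then obtain m where m: "m \<in> F" "\<forall>a\<in>F. m \<sqsubseteq> a" by auto
        show ?case
        proof (cases "m \<sqsubseteq> b")
          case True
          then show ?thesis using m by auto
        next
          case False
          then have "b \<sqsubseteq> m" using insert.prems m by auto
          then have "\<forall>a\<in>insert b F. b \<sqsubseteq> a"
            using m insert.prems by (auto intro: le_trans)
          then show ?thesis by blast
        qed
      qed auto
      then obtain m where m: "m \<in> C" "\<forall>a\<in>C. m \<sqsubseteq> a" by blast
      have "\<exists>c. set c = C - {m} \<and> distinct c \<and> sorted_wrt (\<sqsubset>) c"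
        using psubset.prems m by (intro psubset.IH) auto
      then obtain c where "set c = C - {m}" "distinct c" "sorted_wrt (\<sqsubset>) c" by blast
      moreover from this m have "\<forall>a\<in>set c. m \<sqsubset> a" by (auto simp: lless_eq)
      ultimately show ?thesis
        using m by (intro exI[of _ "m # c"]) auto
    qed auto
  qed
  then show ?thesis using that by blast
qed

section \<open>Sorting by labels and the lexicographic order\<close>

text \<open>Compares heads: \<open>w i \<le> w j\<close> and \<open>w j \<le> w' j\<close>. A strict
  inequality decides the order; equality forces \<open>j = i\<close> by strict sortedness, and the
  tails are compared. Separate weights are needed because a chain to \<open>{}\<close> through
  another coset of \<open>H\<close> may have other labels; \<open>us\<close> and \<open>vs\<close>
  make room for the final label \<open>0\<close>.\<close>

lemma lex_least_if_sorted_wrt_weights: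
  fixes w w' :: "'i \<Rightarrow> 'l::linorder"
  assumes "sorted_wrt (\<lambda>i j. w i < w j) is" "distinct js" "set js = set is"
    and "\<forall>i\<in>set is. w i \<le> w' i"
  shows "map w is = map w' js \<or> (map w is @ us, map w' js @ vs) \<in> lexord {(a, b). a < b}"
  using assms
proof (induction "is" arbitrary: js)
  case (Cons i "is")
  then obtain j js' where js: "js = j # js'" by (cases js) auto
  have j: "j \<in> set (i # is)" using Cons.prems js by auto
  then have ij: "w i \<le> w j" using Cons.prems by auto
  also have "w j \<le> w' j" using Cons.prems j by blast
  finally consider "w i < w' j" | "w i = w' j" by force
  then show ?case
  proof cases
    case 2
    with ij \<open>w j \<le> w' j\<close> have "w i = w j" by simp
    with j Cons.prems have "j = i" by auto
    have i: "i \<notin> set is" using Cons.prems by auto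
    have "set js' = set is"
      using Cons.prems(2,3) js \<open>j = i\<close> i by (metis Diff_insert_absorb distinct.simps(2) list.simps(15))
    then have "map w is = map w' js' \<or> (map w is @ us, map w' js' @ vs) \<in> lexord {(a, b). a < b}"
      using Cons.prems js by (intro Cons.IH) auto
    then show ?thesis using 2 js by auto
  qed (simp add: js)
qed auto

lemma sorted_wrt_weights_unique:
  fixes w :: "'i \<Rightarrow> 'l::linorder"
  assumes "sorted_wrt (\<lambda>i j. w i < w j) is" "sorted_wrt (\<lambda>i j. w i < w j) js" "set is = set js"
  shows "is = js"
  using assms
proof (induction "is" arbitrary: js)
  case (Cons i "is")
  then obtain j js' where js: "js = j # js'" by (cases js) auto
  have "i \<in> set (j # js')" "j \<in> set (i # is)" using Cons.prems js by auto
  then have "i = j" using Cons.prems js by fastforce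
  moreover have "i \<notin> set is" "j \<notin> set js'" using Cons.prems js by auto
  ultimately have "is = js'" using Cons.prems js by (intro Cons.IH) auto
  then show ?case using \<open>i = j\<close> js by simp
qed auto

lemma ex_sorted_wrt_weights:
  fixes w :: "'i \<Rightarrow> 'l::linorder"
  assumes "finite A" "inj_on w A"
  obtains "is" where "distinct is" "set is = A" "sorted_wrt (\<lambda>i j. w i < w j) is"
proof -
  obtain xs where xs: "set xs = A" "distinct xs" using finite_distinct_list[OF assms(1)] by blast
  then have "distinct (map w (sort_key w xs))" using assms by (simp add: distinct_map)
  then have "sorted_wrt (<) (map w (sort_key w xs))" by (simp add: strict_sorted_iff)
  then show ?thesis using xs by (intro that[of "sort_key w xs"]) (simp_all add: sorted_wrt_map)
qed

lemma label_sequence_Cons_Cons [simp]: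
  "label_sequence l (x # y # c) = l x y # label_sequence l (y # c)"
  by (simp add: label_sequence_def)

lemma label_sequence_Nil [simp]: "label_sequence l [] = []" "label_sequence l [x] = []"
  by (simp_all add: label_sequence_def)

lemma label_sequence_snoc:
  "c \<noteq> [] \<Longrightarrow> label_sequence l (c @ [z]) = label_sequence l c @ [l (last c) z]"
  by (induction c rule: induct_list012) auto

section \<open>Boolean intervals of subgroups\<close>

text \<open>Coordinates on the Boolean interval: \<open>X\<close> is an order isomorphism from the
  subsets of \<open>{1..n}\<close> onto the interval and sends singletons to the atoms. Lattice
  questions thereby become questions about index sets.\<close>

locale boolean_subgroup_interval = group G for G (structure) +
  fixes H :: "'a set" and K :: "nat \<Rightarrow> 'a set" and n :: nat and X :: "nat set \<Rightarrow> 'a set"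
  assumes subgroup_X: "T \<subseteq> {1..n} \<Longrightarrow> subgroup (X T) G"
    and X_subset_iff: "S \<subseteq> {1..n} \<Longrightarrow> T \<subseteq> {1..n} \<Longrightarrow> X S \<subseteq> X T \<longleftrightarrow> S \<subseteq> T"
    and X_surj: "subgroup U G \<Longrightarrow> H \<subseteq> U \<Longrightarrow> \<exists>T\<subseteq>{1..n}. U = X T"
    and X_empty: "X {} = H"
    and X_singleton: "i \<in> {1..n} \<Longrightarrow> X {i} = K i"
    and finite_carrier: "finite (carrier G)"
begin

declare One_nat_def [simp del]

abbreviation "L \<equiv> subgroup_interval G H"

lemma X_eq_iff: "S \<subseteq> {1..n} \<Longrightarrow> T \<subseteq> {1..n} \<Longrightarrow> X S = X T \<longleftrightarrow> S = T"
  using X_subset_iff by (metis subset_antisym order_refl)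

lemma X_mono: "S \<subseteq> T \<Longrightarrow> T \<subseteq> {1..n} \<Longrightarrow> X S \<subseteq> X T"
  using X_subset_iff[of S T] by auto

lemma carrier_L: "carrier L = X ` Pow {1..n}"
proof -
  have "H \<subseteq> X T" if "T \<subseteq> {1..n}" for T
    using X_subset_iff[of "{}" T] that X_empty by simp
  then show ?thesis
    using X_surj subgroup_X unfolding subgroup_interval_def image_def by simp blast
qed

lemma le_L [simp]: "le L = (\<subseteq>)"
  by (simp add: subgroup_interval_def)

lemma X_subset_carrier: "T \<subseteq> {1..n} \<Longrightarrow> X T \<subseteq> carrier G"
  using subgroup_X subgroup.subset by blast

lemma X_full: "X {1..n} = carrier G"
proof -
  have "H \<subseteq> carrier G" using X_subset_carrier[of "{}"] X_empty by simp
  then obtain T where T: "T \<subseteq> {1..n}" "carrier G = X T"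
    using X_surj[OF subgroup_self] by auto
  then have "X T \<subseteq> X {1..n}" using X_subset_iff[of T "{1..n}"] by simp
  then show ?thesis using T X_subset_carrier[of "{1..n}"] by auto
qed

text \<open>The intersection is again a subgroup above \<open>H\<close>, hence some
  \<open>X U\<close>, and the order embedding identifies \<open>U\<close>. Meets are thus plain
  intersections.\<close>

lemma X_Int:
  assumes "S \<subseteq> {1..n}" "T \<subseteq> {1..n}"
  shows "X (S \<inter> T) = X S \<inter> X T"
proof -
  have "subgroup (X S \<inter> X T) G"
    using assms subgroup_X by (intro subgroups_Inter_pair) auto
  moreover have "H \<subseteq> X S \<inter> X T"
    using assms X_subset_iff[of "{}"] X_empty by auto
  ultimately obtain U where U: "U \<subseteq> {1..n}" "X S \<inter> X T = X U"
    using X_surj by blast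
  then have "X U \<subseteq> X S" "X U \<subseteq> X T" by auto
  then have "U \<subseteq> S \<inter> T" using U assms X_subset_iff by auto
  moreover have "S \<inter> T \<subseteq> {1..n}" using assms by blast
  moreover from this have "X (S \<inter> T) \<subseteq> X S \<inter> X T"
    using assms X_subset_iff by auto
  ultimately show ?thesis using U X_subset_iff by blast
qed

text \<open>The join is chosen by \<open>SOME\<close>, so both existence and uniqueness of the least
  upper bound are shown.\<close>

lemma join_X:
  assumes "S \<subseteq> {1..n}" "T \<subseteq> {1..n}"
  shows "X S \<squnion>\<^bsub>L\<^esub> X T = X (S \<union> T)"
  unfolding join_def sup_def
proof (rule some_equality)
  have ST: "S \<union> T \<subseteq> {1..n}" using assms by simp
  have U: "Upper L {X S, X T} = X ` {U. U \<subseteq> {1..n} \<and> S \<union> T \<subseteq> U}"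
    using assms subsetD[OF X_mono] by (auto simp: Upper_def carrier_L X_subset_iff)
  show *: "least L (X (S \<union> T)) (Upper L {X S, X T})"
    unfolding U least_def using ST by (auto simp: carrier_L X_subset_iff)
  show "x = X (S \<union> T)" if "least L x (Upper L {X S, X T})" for x
    using least_le[OF that least_mem[OF *]] least_le[OF * least_mem[OF that]] by simp
qed

lemma meet_X:
  assumes "S \<subseteq> {1..n}" "T \<subseteq> {1..n}"
  shows "X S \<sqinter>\<^bsub>L\<^esub> X T = X (S \<inter> T)"
  unfolding meet_def inf_def
proof (rule some_equality)
  have ST: "S \<inter> T \<subseteq> {1..n}" using assms by auto
  have U: "Lower L {X S, X T} = {U \<in> carrier L. U \<subseteq> X (S \<inter> T)}"
    using assms by (auto simp: Lower_def X_Int carrier_L)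
  show *: "greatest L (X (S \<inter> T)) (Lower L {X S, X T})"
    unfolding U greatest_def using ST by (auto simp: carrier_L)
  show "x = X (S \<inter> T)" if "greatest L x (Lower L {X S, X T})" for x
    using greatest_le[OF that greatest_mem[OF *]] greatest_le[OF * greatest_mem[OF that]] by simp
qed

lemma bottom_L: "\<bottom>\<^bsub>L\<^esub> = X {}"
  unfolding bottom_def
proof (rule some_equality)
  show *: "least L (X {}) (carrier L)"
    unfolding least_def by (auto simp: carrier_L X_subset_iff)
  show "x = X {}" if "least L x (carrier L)" for x
    using least_le[OF that least_mem[OF *]] least_le[OF * least_mem[OF that]] by simp
qed

lemma top_L: "\<top>\<^bsub>L\<^esub> = X {1..n}"
  unfolding top_def
proof (rule some_equality)
  show *: "greatest L (X {1..n}) (carrier L)"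
    unfolding greatest_def by (auto simp: carrier_L X_subset_iff)
  show "x = X {1..n}" if "greatest L x (carrier L)" for x
    using greatest_le[OF that greatest_mem[OF *]] greatest_le[OF * greatest_mem[OF that]] by simp
qed

lemma lattice_complement_X:
  assumes "T \<subseteq> {1..n}"
  shows "lattice_complement L (X T) = X ({1..n} - T)"
  unfolding lattice_complement_def
proof (rule the_equality)
  show "X ({1..n} - T) \<in> carrier L \<and> X T \<sqinter>\<^bsub>L\<^esub> X ({1..n} - T) = \<bottom>\<^bsub>L\<^esub> \<and>
      X T \<squnion>\<^bsub>L\<^esub> X ({1..n} - T) = \<top>\<^bsub>L\<^esub>"
  proof -
    have "T \<inter> ({1..n} - T) = {}" "T \<union> ({1..n} - T) = {1..n}" using assms by auto
    then show ?thesis using assms by (simp add: carrier_L meet_X join_X bottom_L top_L)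
  qed
next
  fix y assume y: "y \<in> carrier L \<and> X T \<sqinter>\<^bsub>L\<^esub> y = \<bottom>\<^bsub>L\<^esub> \<and> X T \<squnion>\<^bsub>L\<^esub> y = \<top>\<^bsub>L\<^esub>"
  then obtain U where U: "U \<subseteq> {1..n}" "y = X U" by (auto simp: carrier_L)
  then have "X (T \<inter> U) = X {}" "X (T \<union> U) = X {1..n}"
    using y assms by (simp_all add: meet_X join_X bottom_L top_L)
  moreover have "T \<inter> U \<subseteq> {1..n}" "T \<union> U \<subseteq> {1..n}" using U assms by auto
  ultimately have "T \<inter> U = {}" "T \<union> U = {1..n}" by (simp_all add: X_eq_iff)
  then have "U = {1..n} - T" by auto
  then show "y = X ({1..n} - T)" using U by simp
qed

lemma group_complemented_iff:
  "group_complemented G H \<longleftrightarrow> (\<forall>T\<subseteq>{1..n}. X T <#> X ({1..n} - T) = carrier G)"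
  by (auto simp: group_complemented_def carrier_L lattice_complement_X)

section \<open>Cosets of the subgroups in the interval\<close>

lemma mem_coset_iff:
  assumes "T \<subseteq> {1..n}" "g \<in> carrier G"
  shows "h \<in> X T #> g \<longleftrightarrow> h \<in> carrier G \<and> h \<otimes> inv g \<in> X T"
proof -
  interpret X: subgroup "X T" G using subgroup_X assms by blast
  show ?thesis
    using X.rcos_module[OF is_group] X.elemrcos_carrier[OF is_group] assms by blast
qed

lemma coset_self: "T \<subseteq> {1..n} \<Longrightarrow> g \<in> carrier G \<Longrightarrow> g \<in> X T #> g"
  by (intro rcos_self subgroup_X)

lemma coset_repr:
  "T \<subseteq> {1..n} \<Longrightarrow> g \<in> carrier G \<Longrightarrow> h \<in> X T #> g \<Longrightarrow> X T #> h = X T #> g"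
  using repr_independence subgroup_X by metis

lemma coset_mono: "S \<subseteq> T \<Longrightarrow> T \<subseteq> {1..n} \<Longrightarrow> X S #> g \<subseteq> X T #> g"
  using X_subset_iff[of S T] by (auto simp: r_coset_def)

lemma coset_Int:
  assumes "S \<subseteq> {1..n}" "T \<subseteq> {1..n}" "g \<in> carrier G"
  shows "(X S #> g) \<inter> (X T #> g) = X (S \<inter> T) #> g"
proof -
  have ST: "S \<inter> T \<subseteq> {1..n}" using assms by auto
  show ?thesis
    using mem_coset_iff[OF ST assms(3)] assms by (auto simp: mem_coset_iff X_Int)
qed

text \<open>The inclusion puts \<open>g\<close> into the upper coset, so both can be based at
  \<open>g\<close>; cancelling \<open>g\<close> leaves an inclusion of subgroups.\<close>

lemma coset_subset_iff:
  assumes "S \<subseteq> {1..n}" "T \<subseteq> {1..n}" "g \<in> carrier G" "h \<in> carrier G"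
  shows "X S #> g \<subseteq> X T #> h \<longleftrightarrow> S \<subseteq> T \<and> g \<in> X T #> h"
proof
  assume sub: "X S #> g \<subseteq> X T #> h"
  then have g: "g \<in> X T #> h" using coset_self assms by blast
  then have sub': "X S #> g \<subseteq> X T #> g" using sub coset_repr[OF assms(2,4) g] by simp
  have "x \<in> X T" if "x \<in> X S" for x
  proof -
    have "x \<in> carrier G" using that assms X_subset_carrier by blast
    moreover have "x \<otimes> g \<in> X T #> g" using that sub' by (auto simp: r_coset_def)
    ultimately show ?thesis using assms by (simp add: mem_coset_iff m_assoc)
  qed
  then show "S \<subseteq> T \<and> g \<in> X T #> h" using g assms X_subset_iff[of S T] by auto
next
  assume "S \<subseteq> T \<and> g \<in> X T #> h"
  then show "X S #> g \<subseteq> X T #> h"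
    using coset_mono[of S T g] coset_repr[of T h g] assms by simp
qed

lemma coset_eqD:
  assumes "S \<subseteq> {1..n}" "T \<subseteq> {1..n}" "g \<in> carrier G" "h \<in> carrier G" "X S #> g = X T #> h"
  shows "S = T"
  using assms coset_subset_iff[of S T g h] coset_subset_iff[of T S h g] by auto

lemma coset_nonempty: "T \<subseteq> {1..n} \<Longrightarrow> g \<in> carrier G \<Longrightarrow> X T #> g \<noteq> {}"
  using coset_self by blast

section \<open>Edge labels in coordinates\<close>

text \<open>A coset determines its index set, so any admissible \<open>j\<close> satisfies
  \<open>insert i S = insert j S\<close> with neither index in \<open>S\<close>.\<close>

lemma edge_index_X:
  assumes "S \<subseteq> {1..n}" "i \<in> {1..n}" "i \<notin> S" "g \<in> carrier G"
  shows "edge_index G H K n (X S #> g) (X (insert i S) #> g) = i"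
  unfolding edge_index_def
proof (rule the_equality)
  have iS: "insert i S \<subseteq> {1..n}" using assms by simp
  have "X (insert i S) = X S \<squnion>\<^bsub>L\<^esub> K i"
    using assms join_X[of S "{i}"] by (simp add: X_singleton)
  moreover have "\<not> K i \<subseteq> X S"
    using assms X_subset_iff[of "{i}" S] by (simp add: X_singleton)
  moreover have "X S \<in> carrier L" "X (insert i S) \<in> carrier L"
    using iS by (auto simp: carrier_L)
  ultimately show "i \<in> {1..n} \<and> (\<exists>U\<in>carrier L. \<exists>V\<in>carrier L. \<exists>h\<in>carrier G.
      X S #> g = U #> h \<and> X (insert i S) #> g = V #> h \<and> V = U \<squnion>\<^bsub>L\<^esub> K i \<and> \<not> K i \<subseteq> U)"
    using assms by blast
next
  fix j
  assume j: "j \<in> {1..n} \<and> (\<exists>U\<in>carrier L. \<exists>V\<in>carrier L. \<exists>h\<in>carrier G.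
      X S #> g = U #> h \<and> X (insert i S) #> g = V #> h \<and> V = U \<squnion>\<^bsub>L\<^esub> K j \<and> \<not> K j \<subseteq> U)"
  then obtain U V h where UV: "U \<subseteq> {1..n}" "V \<subseteq> {1..n}" "h \<in> carrier G" "X S #> g = X U #> h"
    "X (insert i S) #> g = X V #> h" "X V = X U \<squnion>\<^bsub>L\<^esub> K j" "\<not> K j \<subseteq> X U"
    unfolding carrier_L by blast
  have iS: "insert i S \<subseteq> {1..n}" using assms by simp
  have eqs: "U = S" "V = insert i S"
    using coset_eqD[OF assms(1) UV(1) assms(4) UV(3,4)] coset_eqD[OF iS UV(2) assms(4) UV(3,5)]
    by auto
  have "X V = X (insert j U)"
    using UV(6) join_X[OF UV(1), of "{j}"] j by (simp add: X_singleton)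
  then have "V = insert j U" using UV j by (subst (asm) X_eq_iff) auto
  then have "insert i S = insert j S" using eqs by simp
  moreover have "j \<notin> S"
    using UV(1,7) X_subset_iff[of "{j}" U] j eqs by (simp add: X_singleton)
  ultimately show "j = i" by blast
qed

text \<open>The label of the step between two cosets through \<open>g\<close> that differ in the
  index \<open>i\<close>; \<open>X ({1..n} - {i})\<close> is the coatom complementary to the atom
  \<open>K i\<close>. The other indices do not enter, so reordering the steps of a chain only
  permutes its labels.\<close>

definition edge_label :: "'a \<Rightarrow> nat \<Rightarrow> int" where
  "edge_label g i = (if g \<in> X ({1..n} - {i}) then - int i else int i)"

text \<open>If \<open>g\<close> lies in the coatom \<open>?M\<close>, then
  \<open>?M #> g = ?M\<close>, and intersecting cosets through \<open>g\<close> intersects their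
  index sets. If not, the lower coset contains \<open>g\<close> and so is not inside
  \<open>?M\<close>.\<close>

lemma el_coset:
  assumes "S \<subseteq> {1..n}" "i \<in> {1..n}" "i \<notin> S" "g \<in> carrier G"
  shows "el G H K n (X S #> g) (X (insert i S) #> g) = edge_label g i"
proof -
  let ?M = "X ({1..n} - {i})"
  have iS: "insert i S \<subseteq> {1..n}" using assms by simp
  have M: "lattice_complement L (K i) = ?M"
    using lattice_complement_X[of "{i}"] assms by (simp add: X_singleton)
  have "X S #> g = (X (insert i S) #> g) \<inter> ?M \<longleftrightarrow> g \<in> ?M"
  proof
    assume "X S #> g = (X (insert i S) #> g) \<inter> ?M"
    then show "g \<in> ?M" using coset_self assms by blast
  next
    assume "g \<in> ?M"
    then have "?M #> g = ?M"
      by (intro coset_join2 assms subgroup_X) auto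
    moreover have "insert i S \<inter> ({1..n} - {i}) = S" using assms by auto
    ultimately show "X S #> g = (X (insert i S) #> g) \<inter> ?M"
      using coset_Int[OF iS, of "{1..n} - {i}" g] assms by simp
  qed
  then show ?thesis
    using assms coset_nonempty
    by (simp add: el_def edge_index_X M edge_label_def)
qed

text \<open>The complement of \<open>X T\<close> is the intersection of the coatoms with index in
  \<open>T\<close>; for empty \<open>T\<close> this is the whole group.\<close>

lemma mem_all_coatoms_iff:
  assumes "g \<in> carrier G" "T \<subseteq> {1..n}"
  shows "(\<forall>i\<in>T. g \<in> X ({1..n} - {i})) \<longleftrightarrow> g \<in> X ({1..n} - T)"
proof -
  have "finite T" using assms finite_subset by blast
  then show ?thesis using assms(2)
  proof (induction T)
    case (insert i T)
    have "{1..n} - insert i T = ({1..n} - {i}) \<inter> ({1..n} - T)" by auto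
    then have "X ({1..n} - insert i T) = X ({1..n} - {i}) \<inter> X ({1..n} - T)"
      by (simp add: X_Int)
    then show ?case using insert by simp
  qed (simp add: assms X_full)
qed

subsection \<open>The dual of the bounded coset poset\<close>

abbreviation "Q \<equiv> inv_gorder (bounded_coset_poset G H)"

text \<open>Covers in \<open>Q\<close> run from the larger to the smaller coset, while
  \<open>el\<close> takes the smaller one first.\<close>

abbreviation "lab \<equiv> \<lambda>A B. el G H K n B A"

lemma full_coset: "g \<in> carrier G \<Longrightarrow> X {1..n} #> g = carrier G"
  using coset_join2[OF _ subgroup_self, of g] X_full by simp

text \<open>The whole group is the coset \<open>X {1..n} #> g\<close>, so it joins the proper cosets
  and only \<open>{}\<close> needs separate treatment.\<close>

lemma carrier_Q: "carrier Q = insert {} {X T #> g | T g. T \<subseteq> {1..n} \<and> g \<in> carrier G}"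
proof -
  have mem: "A \<in> coset_poset G H \<union> {carrier G} \<longleftrightarrow> (\<exists>T g. T \<subseteq> {1..n} \<and> g \<in> carrier G \<and> A = X T #> g)" for A
  proof
    assume "A \<in> coset_poset G H \<union> {carrier G}"
    then consider "A = carrier G" | "A \<in> coset_poset G H" by blast
    then show "\<exists>T g. T \<subseteq> {1..n} \<and> g \<in> carrier G \<and> A = X T #> g"
    proof cases
      case 1
      then show ?thesis using full_coset[OF one_closed] by blast
    next
      case 2
      then show ?thesis unfolding coset_poset_def carrier_L by blast
    qed
  next
    assume "\<exists>T g. T \<subseteq> {1..n} \<and> g \<in> carrier G \<and> A = X T #> g"
    then obtain T g where T: "T \<subseteq> {1..n}" "g \<in> carrier G" "A = X T #> g" by blast
    then show "A \<in> coset_poset G H \<union> {carrier G}"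
    proof (cases "X T = carrier G")
      case True
      then show ?thesis using T full_coset X_full by simp
    next
      case False
      then show ?thesis using T unfolding coset_poset_def carrier_L by blast
    qed
  qed
  have "coset_poset G H \<union> {carrier G} = {X T #> g | T g. T \<subseteq> {1..n} \<and> g \<in> carrier G}"
    by (rule Set.set_eqI, unfold mem mem_Collect_eq) blast
  then show ?thesis unfolding bounded_coset_poset_def by simp
qed

lemma coset_in_Q: "T \<subseteq> {1..n} \<Longrightarrow> g \<in> carrier G \<Longrightarrow> X T #> g \<in> carrier Q"
  unfolding carrier_Q by blast

lemma empty_in_Q: "{} \<in> carrier Q"
  unfolding carrier_Q by blast

lemma Q_cases:
  assumes "A \<in> carrier Q"
  obtains "A = {}" | T g where "T \<subseteq> {1..n}" "g \<in> carrier G" "A = X T #> g"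
  using assms unfolding carrier_Q by blast

lemma le_Q: "A \<sqsubseteq>\<^bsub>Q\<^esub> B \<longleftrightarrow> B \<subseteq> A"
  by (simp add: bounded_coset_poset_def)

lemma lless_Q: "A \<sqsubset>\<^bsub>Q\<^esub> B \<longleftrightarrow> B \<subset> A"
  by (auto simp: bounded_coset_poset_def lless_def)

lemma covers_Q_psubset: "covers Q A B \<Longrightarrow> B \<subset> A"
  using coversD(3)[of Q A B] unfolding lless_Q .

lemma coset_subset_carrier: "T \<subseteq> {1..n} \<Longrightarrow> g \<in> carrier G \<Longrightarrow> X T #> g \<subseteq> carrier G"
  by (intro r_coset_subset_G X_subset_carrier)

end

sublocale boolean_subgroup_interval \<subseteq> Q: partial_order Q
  by unfold_locales (auto simp: bounded_coset_poset_def)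

context boolean_subgroup_interval
begin

section \<open>Cover relations\<close>

text \<open>A strictly intermediate element contains \<open>g\<close>, hence is some
  \<open>X U #> g\<close> with \<open>U\<close> strictly between \<open>T - {i}\<close> and
  \<open>T\<close>, which is impossible.\<close>

lemma covers_coset:
  assumes "T \<subseteq> {1..n}" "i \<in> T" "g \<in> carrier G"
  shows "covers Q (X T #> g) (X (T - {i}) #> g)"
proof -
  have Ti: "T - {i} \<subseteq> {1..n}" using assms by auto
  have "False" if Z: "Z \<in> carrier Q" "Z \<subset> X T #> g" "X (T - {i}) #> g \<subset> Z" for Z
    using Z(1)
  proof (cases rule: Q_cases)
    case 1
    then show ?thesis using Z by auto
  next
    case (2 U h)
    have "g \<in> Z" using Z coset_self[OF Ti assms(3)] by blast
    then have ZU: "Z = X U #> g" using 2 coset_repr by simp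
    have "T - {i} \<subseteq> U"
      using Z(3) ZU coset_subset_iff[OF Ti 2(1) assms(3) assms(3)] by auto
    moreover have "U \<subseteq> T"
      using Z(2) ZU coset_subset_iff[OF 2(1) assms(1) assms(3) assms(3)] by auto
    moreover have "U \<noteq> T" "U \<noteq> T - {i}" using Z ZU by auto
    ultimately show False using assms by auto
  qed
  moreover have "X (T - {i}) #> g \<subset> X T #> g"
    using coset_mono[of "T - {i}" T g] coset_eqD[OF Ti assms(1,3,3)] assms by blast
  ultimately show ?thesis
    using coset_in_Q assms Ti unfolding covers_def lless_Q by blast
qed

text \<open>A nonempty element inside a coset of \<open>H\<close> contains the coset of
  \<open>H\<close> through any of its points, and that is already the given coset.\<close>

lemma covers_empty:
  assumes "g \<in> carrier G"
  shows "covers Q (X {} #> g) {}"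
proof -
  have "False" if Z: "Z \<in> carrier Q" "Z \<subset> X {} #> g" "Z \<noteq> {}" for Z
    using Z(1)
  proof (cases rule: Q_cases)
    case (2 U h)
    then have hZ: "h \<in> Z" using coset_self by simp
    then have "X {} #> h = X {} #> g" using Z assms coset_repr[of "{}" g h] by blast
    then have "X {} #> h \<subseteq> Z" "X {} #> h = X {} #> g" using 2 coset_mono[of "{}" U] by auto
    then show False using Z by auto
  qed (use Z in auto)
  moreover have "{} \<subset> X {} #> g" using coset_nonempty[of "{}" g] assms by auto
  ultimately show ?thesis
    using coset_in_Q[of "{}" g] assms empty_in_Q unfolding covers_def lless_Q by blast
qed

text \<open>If \<open>B\<close> is a coset \<open>X U #> h\<close>, choose \<open>i\<close> in
  \<open>T\<close> outside \<open>U\<close>; then \<open>X (T - {i}) #> h\<close> lies in between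
  and must equal \<open>B\<close>. If \<open>B\<close> is empty and \<open>T\<close> is not,
  \<open>X {} #> g\<close> lies strictly between. The representative \<open>h\<close> is new, as a
  step down may choose among several cosets.\<close>

lemma covers_cosetE:
  assumes "covers Q (X T #> g) B" "T \<subseteq> {1..n}" "g \<in> carrier G"
  obtains "T = {}" "B = {}"
  | i h where "i \<in> T" "h \<in> X T #> g" "B = X (T - {i}) #> h"
proof -
  have B: "B \<in> carrier Q" "B \<subset> X T #> g" using coversD[OF assms(1)] by (auto simp: lless_Q)
  have no: "\<not> (Z \<subset> X T #> g \<and> B \<subset> Z)" if "Z \<in> carrier Q" for Z
    using coversD(4)[OF assms(1) that] by (auto simp: lless_Q)
  show ?thesis using B(1)
  proof (cases rule: Q_cases)
    case 1
    have "T = {}"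
    proof (rule ccontr)
      assume "T \<noteq> {}"
      then have "X {} #> g \<noteq> X T #> g" using coset_eqD[of "{}" T g g] assms by auto
      moreover have "X {} #> g \<subseteq> X T #> g" using coset_mono[of "{}" T] assms by auto
      moreover have "X {} #> g \<noteq> {}" "X {} #> g \<in> carrier Q"
        using coset_nonempty[of "{}" g] coset_in_Q[of "{}" g] assms by auto
      ultimately show False using no 1 by blast
    qed
    then show ?thesis using 1 that by blast
  next
    case (2 U h)
    have h: "h \<in> X T #> g" using 2 coset_self B by blast
    then have eq: "X T #> h = X T #> g" using coset_repr assms by blast
    have "U \<subseteq> T" "U \<noteq> T"
      using B 2 eq coset_subset_iff[OF 2(1) assms(2) 2(2) assms(3)] by auto
    then obtain i where i: "i \<in> T" "U \<subseteq> T - {i}" by auto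
    have Ti: "T - {i} \<subseteq> {1..n}" using assms by auto
    have "X (T - {i}) #> h \<subset> X T #> g"
      using coversD(3)[OF covers_coset[OF assms(2) i(1) 2(2)]] eq by (simp add: lless_Q)
    moreover have "B \<subseteq> X (T - {i}) #> h" using coset_mono[OF i(2) Ti] 2 by simp
    ultimately have "B = X (T - {i}) #> h" using no coset_in_Q[OF Ti 2(2)] by blast
    then show ?thesis using that i h by blast
  qed
qed

section \<open>Maximal chains as orderings of index sets\<close>

text \<open>One representative serves the whole descending chain because every member contains the
  last coset. Beyond it, only the order of removal is left to record.\<close>

primrec coset_chain :: "'a \<Rightarrow> nat set \<Rightarrow> nat list \<Rightarrow> 'a set list" where
  "coset_chain g T [] = [X T #> g]"
| "coset_chain g T (i # is) = (X T #> g) # coset_chain g (T - {i}) is"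

lemma coset_chain_ne [simp]: "coset_chain g T is \<noteq> []"
  by (cases "is") auto

lemma hd_coset_chain [simp]: "hd (coset_chain g T is) = X T #> g"
  by (cases "is") auto

lemma last_coset_chain [simp]: "last (coset_chain g T is) = X (T - set is) #> g"
proof (induction "is" arbitrary: T)
  case (Cons i "is")
  have "T - {i} - set is = T - insert i (set is)" by auto
  then show ?case using Cons by simp
qed simp

lemma length_coset_chain [simp]: "length (coset_chain g T is) = Suc (length is)"
  by (induction "is" arbitrary: T) auto

lemma coset_chain_Cons_hd:
  "coset_chain g T is = (X T #> g) # tl (coset_chain g T is)"
  by (cases "is") auto

lemma successively_coset_chain:
  assumes "T \<subseteq> {1..n}" "g \<in> carrier G" "distinct is" "set is \<subseteq> T"
  shows "successively (covers Q) (coset_chain g T is)"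
  using assms
proof (induction "is" arbitrary: T)
  case (Cons i "is")
  then have "successively (covers Q) (coset_chain g (T - {i}) is)"
    by (intro Cons.IH) auto
  then show ?case using covers_coset[of T i g] Cons.prems by (simp add: successively_Cons)
qed simp

lemma label_sequence_coset_chain:
  assumes "T \<subseteq> {1..n}" "g \<in> carrier G" "distinct is" "set is \<subseteq> T"
  shows "label_sequence lab (coset_chain g T is) = map (edge_label g) is"
  using assms
proof (induction "is" arbitrary: T)
  case (Cons i "is")
  then have "label_sequence lab (coset_chain g (T - {i}) is) = map (edge_label g) is"
    by (intro Cons.IH) auto
  moreover have "insert i (T - {i}) = T" using Cons.prems by auto
  then have "lab (X T #> g) (X (T - {i}) #> g) = edge_label g i"
    using el_coset[of "T - {i}" i g] Cons.prems by (simp add: subset_iff)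
  moreover have "label_sequence lab (coset_chain g T (i # is)) =
      lab (X T #> g) (X (T - {i}) #> g) # label_sequence lab (coset_chain g (T - {i}) is)"
    by (subst (1 2) coset_chain_Cons_hd) (subst coset_chain.simps, subst coset_chain_Cons_hd, simp)
  ultimately show ?case by simp
qed simp

text \<open>An element of the last coset lies in every coset of the chain, so it may replace
  \<open>g\<close> throughout.\<close>

lemma coset_chain_cong:
  assumes "T \<subseteq> {1..n}" "g \<in> carrier G" "h \<in> X (T - set is) #> g"
  shows "coset_chain h T is = coset_chain g T is"
  using assms
proof (induction "is" arbitrary: T)
  case Nil
  then show ?case using coset_repr by simp
next
  case (Cons i "is")
  have "T - insert i (set is) = T - {i} - set is" by auto
  then have "coset_chain h (T - {i}) is = coset_chain g (T - {i}) is"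
    using Cons.prems by (intro Cons.IH) auto
  moreover have "h \<in> X T #> g"
    using Cons.prems coset_mono[of "T - set (i # is)" T g] by auto
  then have "X T #> h = X T #> g" using coset_repr Cons.prems by blast
  ultimately show ?case by simp
qed

text \<open>Each cover removes one index but may change the representative. The induction hypothesis
  bases the tail at \<open>g\<close>; then \<open>g\<close> lies in \<open>b\<close>, hence in
  \<open>a\<close>, and the head can be based at \<open>g\<close> too.\<close>

lemma saturated_chain_coset:
  assumes "successively (covers Q) c" "c \<noteq> []" "hd c = X T #> h" "last c = X S #> g"
    and "T \<subseteq> {1..n}" "S \<subseteq> {1..n}" "h \<in> carrier G" "g \<in> carrier G"
  shows "\<exists>is. distinct is \<and> set is = T - S \<and> S \<subseteq> T \<and> c = coset_chain g T is"
  using assms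
proof (induction c arbitrary: T h rule: induct_list012)
  case (2 a)
  then have "T = S" using coset_eqD[of T S h g] by auto
  then show ?case using 2 by (intro exI[of _ "[]"]) auto
next
  case (3 a b c)
  have a: "a = X T #> h" and ab: "covers Q a b" using 3 by auto
  \<comment> \<open>Nothing lies above \<open>{}\<close> in \<open>Q\<close>, so the chain would
    have to end there, but its last element is a coset.\<close>
  have bg: "b \<noteq> {}"
  proof
    assume "b = {}"
    moreover have "last (b # c) \<noteq> {}" using 3 coset_nonempty by simp
    ultimately obtain d c' where "c = d # c'" by (cases c) auto
    then have "covers Q {} d" using 3 \<open>b = {}\<close> by simp
    then show False using covers_Q_psubset by blast
  qed
  from ab[unfolded a] 3(7,9) obtain i k where i: "i \<in> T" "k \<in> X T #> h" "b = X (T - {i}) #> k"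
    using bg by (elim covers_cosetE) auto
  have k: "k \<in> carrier G" using i(2) coset_subset_carrier[OF 3(7,9)] by blast
  have Ti: "T - {i} \<subseteq> {1..n}" using 3(7) by auto
  have "\<exists>is. distinct is \<and> set is = T - {i} - S \<and> S \<subseteq> T - {i} \<and> b # c = coset_chain g (T - {i}) is"
  proof (rule 3(2))
    show "successively (covers Q) (b # c)" "last (b # c) = X S #> g" using 3(3,6) by simp_all
    show "hd (b # c) = X (T - {i}) #> k" using i(3) by simp
  qed (use Ti k 3(8,10) in simp_all)
  then obtain "is" where "is": "distinct is" "set is = T - {i} - S" "S \<subseteq> T - {i}"
    "b # c = coset_chain g (T - {i}) is" by blast
  have "b = X (T - {i}) #> g"
    using arg_cong[OF "is"(4), of hd] by simp
  then have "g \<in> b" using coset_self[OF Ti 3(10)] by simp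
  then have "g \<in> X T #> h" using covers_Q_psubset[OF ab] a by blast
  then have "a = X T #> g" using a coset_repr[OF 3(7,9)] by simp
  moreover have "set (i # is) = T - S" "distinct (i # is)" "S \<subseteq> T" using "is" i(1) by auto
  ultimately show ?case using "is"(4) by (intro exI[of _ "i # is"]) simp
qed simp

text \<open>The element before \<open>{}\<close> must be a coset of \<open>H\<close>, since no
  larger coset is adjacent to \<open>{}\<close>. Its representative \<open>g\<close> then describes
  the rest of the chain by \<open>saturated_chain_coset\<close>.\<close>

lemma saturated_chain_empty:
  assumes "successively (covers Q) c" "c \<noteq> []" "hd c = X T #> h" "last c = {}"
    and "T \<subseteq> {1..n}" "h \<in> carrier G"
  shows "\<exists>g is. g \<in> X T #> h \<and> distinct is \<and> set is = T \<and> c = coset_chain g T is @ [{}]"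
proof -
  obtain c' where c: "c = c' @ [{}]" using assms by (cases c rule: rev_cases) auto
  have "c' \<noteq> []" using c assms coset_nonempty[of T h] by auto
  then have c': "successively (covers Q) c'" "covers Q (last c') {}" "hd c' = X T #> h"
    using assms c by (auto simp: successively_append_iff)
  from coversD(1)[OF c'(2)] obtain g where g: "g \<in> carrier G" "last c' = X {} #> g"
  proof (cases rule: Q_cases)
    case 1
    then show ?thesis using covers_Q_psubset[OF c'(2)] by blast
  next
    case (2 U g)
    from c'(2)[unfolded 2(3)] 2(1,2) show ?thesis
    proof (cases rule: covers_cosetE)
      case 1
      then show ?thesis using that 2 by simp
    next
      case (2 i k)
      have "k \<in> carrier G" using 2(2) coset_subset_carrier[OF \<open>U \<subseteq> {1..n}\<close> \<open>g \<in> carrier G\<close>] by blast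
      moreover have "U - {i} \<subseteq> {1..n}" using \<open>U \<subseteq> {1..n}\<close> by auto
      ultimately show ?thesis using 2(3) coset_nonempty by metis
    qed
  qed
  from saturated_chain_coset[OF c'(1) \<open>c' \<noteq> []\<close> c'(3) g(2)] assms g
  obtain "is" where "is": "distinct is" "set is = T" "c' = coset_chain g T is" by auto
  then have "X T #> g = X T #> h" using c' by simp
  then have "g \<in> X T #> h" using coset_self assms g by blast
  then show ?thesis using "is" c by blast
qed

lemma successively_coset_chain_snoc:
  assumes "T \<subseteq> {1..n}" "g \<in> carrier G" "distinct is" "set is = T"
  shows "successively (covers Q) (coset_chain g T is @ [{}])"
  using successively_coset_chain[OF assms(1-3)] covers_empty[OF assms(2)] assms(4)
  by (simp add: successively_append_iff)

lemma label_sequence_coset_chain_snoc: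
  assumes "T \<subseteq> {1..n}" "g \<in> carrier G" "distinct is" "set is = T"
  shows "label_sequence lab (coset_chain g T is @ [{}]) = map (edge_label g) is @ [0]"
  using label_sequence_coset_chain[OF assms(1-3)] assms(4)
  by (simp add: label_sequence_snoc el_def)

lemma maximal_chain_coset_iff:
  assumes "S \<subseteq> T" "T \<subseteq> {1..n}" "g \<in> carrier G"
  shows "maximal_chain_between Q (X T #> g) (X S #> g) c \<longleftrightarrow>
    (\<exists>is. distinct is \<and> set is = T - S \<and> c = coset_chain g T is)"
proof -
  have S: "S \<subseteq> {1..n}" using assms by auto
  have iff: "maximal_chain_between Q (X T #> g) (X S #> g) c \<longleftrightarrow>
    c \<noteq> [] \<and> hd c = X T #> g \<and> last c = X S #> g \<and> successively (covers Q) c"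
    by (intro Q.maximal_chain_between_iff coset_in_Q assms S)
      (simp only: le_Q coset_mono[OF assms(1,2)])
  have TS: "T - (T - S) = S" using assms by auto
  show ?thesis
  proof
    assume "maximal_chain_between Q (X T #> g) (X S #> g) c"
    then show "\<exists>is. distinct is \<and> set is = T - S \<and> c = coset_chain g T is"
      using saturated_chain_coset[of c T g S g] assms S unfolding iff by blast
  next
    assume "\<exists>is. distinct is \<and> set is = T - S \<and> c = coset_chain g T is"
    then show "maximal_chain_between Q (X T #> g) (X S #> g) c"
      unfolding iff using successively_coset_chain[OF assms(2,3)] TS by auto
  qed
qed

text \<open>Besides the order of removal, such a chain chooses the coset of \<open>H\<close> next to
  \<open>{}\<close>. Different \<open>g\<close> in that coset describe the same chain.\<close>

lemma maximal_chain_empty_iff: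
  assumes "T \<subseteq> {1..n}" "h \<in> carrier G"
  shows "maximal_chain_between Q (X T #> h) {} c \<longleftrightarrow>
    (\<exists>g is. g \<in> X T #> h \<and> distinct is \<and> set is = T \<and> c = coset_chain g T is @ [{}])"
proof -
  have iff: "maximal_chain_between Q (X T #> h) {} c \<longleftrightarrow>
    c \<noteq> [] \<and> hd c = X T #> h \<and> last c = {} \<and> successively (covers Q) c"
    by (intro Q.maximal_chain_between_iff coset_in_Q empty_in_Q assms) (simp only: le_Q empty_subsetI)
  show ?thesis
  proof
    assume "maximal_chain_between Q (X T #> h) {} c"
    then show "\<exists>g is. g \<in> X T #> h \<and> distinct is \<and> set is = T \<and> c = coset_chain g T is @ [{}]"
      using saturated_chain_empty[of c T h] assms unfolding iff by blast
  next
    assume "\<exists>g is. g \<in> X T #> h \<and> distinct is \<and> set is = T \<and> c = coset_chain g T is @ [{}]"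
    then obtain g "is" where g: "g \<in> X T #> h" and "is": "distinct is" "set is = T"
      "c = coset_chain g T is @ [{}]" by blast
    have gG: "g \<in> carrier G" using g coset_subset_carrier[OF assms] by blast
    show "maximal_chain_between Q (X T #> h) {} c"
      unfolding iff using successively_coset_chain_snoc[OF assms(1) gG "is"(1,2)] "is"(3)
        coset_repr[OF assms g] by simp
  qed
qed

lemma maximal_chain_empty_empty_iff: "maximal_chain_between Q {} {} c \<longleftrightarrow> c = [{}]"
proof -
  have "maximal_chain_between Q {} {} c \<longleftrightarrow>
    c \<noteq> [] \<and> hd c = {} \<and> last c = {} \<and> successively (covers Q) c"
    by (intro Q.maximal_chain_between_iff empty_in_Q) (simp only: le_Q empty_subsetI)
  also have "\<dots> \<longleftrightarrow> c = [{}]"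
  proof
    assume c: "c \<noteq> [] \<and> hd c = {} \<and> last c = {} \<and> successively (covers Q) c"
    then obtain c' where c': "c = {} # c'" by (cases c) auto
    have "c' = []"
    proof (rule ccontr)
      assume "c' \<noteq> []"
      then have "covers Q {} (hd c')" using c c' by (simp add: successively_Cons)
      then show False using covers_Q_psubset by blast
    qed
    then show "c = [{}]" using c' by simp
  qed simp
  finally show ?thesis .
qed

section \<open>Gradedness\<close>

text \<open>The poset is the closed interval from the whole group to \<open>{}\<close>, so the list
  description applies to its maximal chains: \<open>n + 1\<close> cosets and \<open>{}\<close>,
  hence \<open>n + 2\<close> elements.\<close>

lemma graded_poset_Q: "graded_poset Q"
proof -
  have X: "X {1..n} #> \<one> = carrier G" by (rule full_coset) simp
  then have top: "carrier G \<in> carrier Q" using coset_in_Q[of "{1..n}" \<one>] by simp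
  have sub: "A \<subseteq> carrier G" if "A \<in> carrier Q" for A
    using that by (cases rule: Q_cases) (use coset_subset_carrier in blast)+
  have least: "least Q (carrier G) (carrier Q)"
    unfolding least_def le_Q using top sub by blast
  have greatest: "greatest Q {} (carrier Q)"
    unfolding greatest_def le_Q using empty_in_Q by blast
  have interval: "at_least_at_most Q (carrier G) {} = carrier Q"
    unfolding at_least_at_most_def le_Q using sub by blast
  have "finite (carrier Q)"
    by (rule finite_subset[of _ "Pow (carrier G)"]) (use sub finite_carrier in auto)
  have "finite C \<and> card C = Suc (Suc n)" if C: "pred_on.maxchain (carrier Q) (lless Q) C" for C
  proof -
    have sub: "C \<subseteq> carrier Q" and tot: "\<forall>a\<in>C. \<forall>b\<in>C. a = b \<or> a \<sqsubset>\<^bsub>Q\<^esub> b \<or> b \<sqsubset>\<^bsub>Q\<^esub> a"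
      using C unfolding pred_on.maxchain_def pred_on.chain_def by auto
    have fin: "finite C" using finite_subset[OF sub \<open>finite (carrier Q)\<close>] .
    have "\<forall>a\<in>C. \<forall>b\<in>C. a \<sqsubseteq>\<^bsub>Q\<^esub> b \<or> b \<sqsubseteq>\<^bsub>Q\<^esub> a"
      using tot unfolding lless_Q le_Q by blast
    then obtain c where c: "set c = C" "distinct c" "sorted_wrt (lless Q) c"
      using Q.finite_chain_sorted_list[OF fin sub] by blast
    then have "maximal_chain_between Q (X {1..n} #> \<one>) {} c"
      using C unfolding maximal_chain_between_def X interval by simp
    then obtain g "is" where "distinct is" "set is = {1..n}" "c = coset_chain g {1..n} is @ [{}]"
      by (subst (asm) maximal_chain_empty_iff) auto
    then have "length c = Suc (Suc n)" using distinct_card[of "is"] by simp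
    then show ?thesis using distinct_card[OF c(2)] c(1) fin by simp
  qed
  then show ?thesis
    unfolding graded_poset_def using Q.partial_order_axioms least greatest by blast
qed

section \<open>Increasing chains in closed intervals\<close>

text \<open>Indices start at \<open>1\<close>, so the sign records membership in the coatom and
  \<open>0\<close> separates the two cases. The least label that index \<open>i\<close> can receive
  is \<open>- int i\<close>, which drives the lexicographic comparison.\<close>

lemma edge_label_coatoms:
  assumes "i \<in> {1..n}"
  shows "edge_label g i < 0 \<longleftrightarrow> g \<in> X ({1..n} - {i})"
    and "g \<in> X ({1..n} - {i}) \<Longrightarrow> edge_label g i = - int i"
    and "- int i \<le> edge_label g i"
  using assms by (auto simp: edge_label_def)

text \<open>The absolute value of a label is its index.\<close>

lemma inj_edge_label: "inj_on (edge_label g) A"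
  by (auto simp: edge_label_def inj_on_def split: if_splits)

text \<open>All maximal chains carry the labels \<open>edge_label g i\<close> for \<open>i\<close>
  in \<open>T - S\<close>, in different orders, and these labels are distinct. Sorting them gives
  the increasing chain.\<close>

lemma EL_coset_interval:
  assumes "S \<subseteq> T" "T \<subseteq> {1..n}" "g \<in> carrier G"
  shows "\<exists>c. maximal_chain_between Q (X T #> g) (X S #> g) c \<and>
    sorted_wrt (<) (label_sequence lab c) \<and>
    (\<forall>d. maximal_chain_between Q (X T #> g) (X S #> g) d \<and> d \<noteq> c \<longrightarrow>
      \<not> sorted_wrt (<) (label_sequence lab d) \<and>
      (label_sequence lab c, label_sequence lab d) \<in> lexord {(a, b). a < b})"
proof -
  have "finite (T - S)" using assms finite_subset by blast
  then obtain "is" where "is": "distinct is" "set is = T - S"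
    "sorted_wrt (\<lambda>i j. edge_label g i < edge_label g j) is"
    using ex_sorted_wrt_weights[OF _ inj_edge_label] by blast
  have lab: "label_sequence lab (coset_chain g T js) = map (edge_label g) js"
    if "distinct js" "set js = T - S" for js
    using label_sequence_coset_chain[OF assms(2,3) that(1)] that(2) by blast
  have unique: "\<not> sorted_wrt (<) (map (edge_label g) js) \<and>
      (map (edge_label g) is, map (edge_label g) js) \<in> lexord {(a, b). a < b}"
    if "distinct js" "set js = T - S" "js \<noteq> is" for js
  proof -
    have ns: "\<not> sorted_wrt (<) (map (edge_label g) js)"
      using sorted_wrt_weights_unique[OF "is"(3), of js] that "is"(2) by (auto simp: sorted_wrt_map)
    moreover have "sorted_wrt (<) (map (edge_label g) is)"
      using "is"(3) by (simp add: sorted_wrt_map)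
    \<comment> \<open>Equality of the two label sequences is then excluded, as only one of them is
      increasing.\<close>
    moreover have "map (edge_label g) is = map (edge_label g) js \<or>
      (map (edge_label g) is @ [], map (edge_label g) js @ []) \<in> lexord {(a, b). a < b}"
      by (rule lex_least_if_sorted_wrt_weights) (use "is" that in auto)
    ultimately show ?thesis by auto
  qed
  show ?thesis
    unfolding maximal_chain_coset_iff[OF assms]
  proof (intro exI[of _ "coset_chain g T is"] conjI allI impI)
    show "sorted_wrt (<) (label_sequence lab (coset_chain g T is))"
      using "is" lab by (simp add: sorted_wrt_map)
  next
    fix d assume "(\<exists>js. distinct js \<and> set js = T - S \<and> d = coset_chain g T js) \<and> d \<noteq> coset_chain g T is"
    then obtain js where js: "distinct js" "set js = T - S" "d = coset_chain g T js" "js \<noteq> is" by blast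
    show "\<not> sorted_wrt (<) (label_sequence lab d)"
      "(label_sequence lab (coset_chain g T is), label_sequence lab d) \<in> lexord {(a, b). a < b}"
      using unique[OF js(1,2,4)] lab[OF js(1,2)] lab[OF "is"(1,2)] js(3) by simp_all
  qed (use "is" in blast)
qed

text \<open>The last label is \<open>0\<close>, so all earlier labels are negative, which puts
  \<open>g\<close> into every coatom with index in \<open>T\<close>. The labels are then the
  \<open>- int i\<close>, so the indices decrease.\<close>

lemma increasing_chain_empty:
  assumes "T \<subseteq> {1..n}" "g \<in> carrier G" "distinct is" "set is = T"
    and "sorted_wrt (<) (label_sequence lab (coset_chain g T is @ [{}]))"
  shows "g \<in> X ({1..n} - T)" "sorted_wrt (\<lambda>i j. - int i < - int j) is"
proof -
  have sorted: "sorted_wrt (\<lambda>i j. edge_label g i < edge_label g j) is" "\<forall>i\<in>T. edge_label g i < 0"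
    using assms(5) label_sequence_coset_chain_snoc[OF assms(1-4)] assms(4)
    by (auto simp: sorted_wrt_append sorted_wrt_map)
  then have mem: "\<forall>i\<in>T. g \<in> X ({1..n} - {i})"
    using edge_label_coatoms(1) assms(1) by blast
  then show "g \<in> X ({1..n} - T)" using mem_all_coatoms_iff assms by blast
  have "\<forall>i\<in>T. edge_label g i = - int i"
    using mem edge_label_coatoms(2) assms(1) by blast
  then show "sorted_wrt (\<lambda>i j. - int i < - int j) is"
    using sorted(1) assms(4) by (auto intro: sorted_wrt_mono_rel[rotated])
qed

text \<open>With \<open>g\<close> in the complement the labels are \<open>- int i\<close>;
  decreasing indices followed by the step to \<open>{}\<close> give the increasing chain. Another
  increasing chain, through \<open>h\<close>, has \<open>h\<close> in the complement as well, and
  this forces the same coset of \<open>H\<close> and the same order.\<close>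

lemma EL_empty_interval:
  assumes "T \<subseteq> {1..n}" "g \<in> carrier G" "g \<in> X ({1..n} - T)"
  shows "\<exists>c. maximal_chain_between Q (X T #> g) {} c \<and>
    sorted_wrt (<) (label_sequence lab c) \<and>
    (\<forall>d. maximal_chain_between Q (X T #> g) {} d \<and> d \<noteq> c \<longrightarrow>
      \<not> sorted_wrt (<) (label_sequence lab d) \<and>
      (label_sequence lab c, label_sequence lab d) \<in> lexord {(a, b). a < b})"
proof -
  have "finite T" using assms finite_subset by blast
  moreover have "inj_on (\<lambda>i. - int i) T" by (auto simp: inj_on_def)
  ultimately obtain "is" where "is": "distinct is" "set is = T"
    "sorted_wrt (\<lambda>i j. - int i < - int j) is"
    using ex_sorted_wrt_weights by blast
  have neg: "\<forall>i\<in>T. edge_label g i = - int i"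
    using mem_all_coatoms_iff[OF assms(2,1)] assms(1,3) edge_label_coatoms(2) by blast
  then have lab: "label_sequence lab (coset_chain g T is @ [{}]) = map (\<lambda>i. - int i) is @ [0]"
    using label_sequence_coset_chain_snoc[OF assms(1,2) "is"(1,2)] "is"(2) by simp
  have "\<forall>i\<in>T. - int i < 0" using assms(1) by (auto simp: subset_iff)
  then have sorted: "sorted_wrt (<) (map (\<lambda>i. - int i) is @ [0])"
    using "is" by (simp add: sorted_wrt_append sorted_wrt_map)
  have unique: "\<not> sorted_wrt (<) (label_sequence lab d) \<and>
      (map (\<lambda>i. - int i) is @ [0], label_sequence lab d) \<in> lexord {(a, b). a < b}"
    if h: "h \<in> X T #> g" and js: "distinct js" "set js = T"
      and d: "d = coset_chain h T js @ [{}]" "d \<noteq> coset_chain g T is @ [{}]" for d h js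
  proof -
    have hG: "h \<in> carrier G" using h coset_subset_carrier[OF assms(1,2)] by blast
    have ns: "\<not> sorted_wrt (<) (label_sequence lab d)"
    proof
      assume "sorted_wrt (<) (label_sequence lab d)"
      then have h': "h \<in> X ({1..n} - T)" and "sorted_wrt (\<lambda>i j. - int i < - int j) js"
        using increasing_chain_empty[OF assms(1) hG js] d by simp_all
      then have "js = is" using sorted_wrt_weights_unique[OF _ "is"(3)] js "is" by simp
      \<comment> \<open>As \<open>h\<close> also lies in \<open>X T #> g\<close>, the quotient lies
        in \<open>X T\<close> and in its complement, which meet in \<open>H\<close>.\<close>
      have "h \<otimes> inv g \<in> X ({1..n} - T)"
        using h' assms(3) subgroup_X[of "{1..n} - T"]
        by (intro subgroup.m_closed subgroup.m_inv_closed) auto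
      then have "h \<in> X ({1..n} - T) #> g" using mem_coset_iff[of "{1..n} - T" g h] hG assms(2) by auto
      moreover have "T \<inter> ({1..n} - T) = {}" by auto
      ultimately have "h \<in> X {} #> g"
        using h coset_Int[OF assms(1) _ assms(2), of "{1..n} - T"] by auto
      then have "coset_chain h T is = coset_chain g T is"
        using coset_chain_cong[OF assms(1,2)] "is"(2) by simp
      then show False using d \<open>js = is\<close> by simp
    qed
    \<comment> \<open>The competing chain has the labels of \<open>h\<close>, each at least
      \<open>- int i\<close>, and both sequences end in \<open>0\<close>.\<close>
    have "map (\<lambda>i. - int i) is = map (edge_label h) js \<or>
      (map (\<lambda>i. - int i) is @ [0], map (edge_label h) js @ [0]) \<in> lexord {(a, b). a < b}"
      by (rule lex_least_if_sorted_wrt_weights)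
        (use "is" js assms(1) edge_label_coatoms(3) in auto)
    then show ?thesis
      using ns sorted label_sequence_coset_chain_snoc[OF assms(1) hG js] d(1) by auto
  qed
  show ?thesis
    unfolding maximal_chain_empty_iff[OF assms(1,2)]
  proof (intro exI[of _ "coset_chain g T is @ [{}]"] conjI allI impI)
    show "\<exists>h js. h \<in> X T #> g \<and> distinct js \<and> set js = T \<and>
        coset_chain g T is @ [{}] = coset_chain h T js @ [{}]"
      using coset_self[OF assms(1,2)] "is" by blast
    show "sorted_wrt (<) (label_sequence lab (coset_chain g T is @ [{}]))"
      using sorted lab by simp
  next
    fix d
    assume "(\<exists>h js. h \<in> X T #> g \<and> distinct js \<and> set js = T \<and> d = coset_chain h T js @ [{}]) \<and>
      d \<noteq> coset_chain g T is @ [{}]"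
    then show "\<not> sorted_wrt (<) (label_sequence lab d)"
      "(label_sequence lab (coset_chain g T is @ [{}]), label_sequence lab d) \<in> lexord {(a, b). a < b}"
      using unique lab by auto
  qed
qed

section \<open>Group complements and the equivalence\<close>

text \<open>For \<open>g = x \<otimes> y\<close> the factor \<open>y = inv x \<otimes> g\<close>
  represents the coset of \<open>g\<close>, and the computation can be reversed.\<close>

lemma mem_set_mult_complement_iff:
  assumes "T \<subseteq> {1..n}" "g \<in> carrier G"
  shows "g \<in> X T <#> X ({1..n} - T) \<longleftrightarrow> (\<exists>h \<in> X T #> g. h \<in> X ({1..n} - T))"
proof
  assume "g \<in> X T <#> X ({1..n} - T)"
  then obtain x y where xy: "x \<in> X T" "y \<in> X ({1..n} - T)" "g = x \<otimes> y"
    by (auto simp: set_mult_def)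
  have G: "x \<in> carrier G" "y \<in> carrier G"
    using xy X_subset_carrier[OF assms(1)] X_subset_carrier[of "{1..n} - T"] by auto
  have "y = inv x \<otimes> g" using xy G by (simp add: m_assoc[symmetric])
  moreover have "inv x \<in> X T" using subgroup.m_inv_closed[OF subgroup_X[OF assms(1)] xy(1)] .
  ultimately have "y \<in> X T #> g" by (auto simp: r_coset_def)
  then show "\<exists>h \<in> X T #> g. h \<in> X ({1..n} - T)" using xy by blast
next
  assume "\<exists>h \<in> X T #> g. h \<in> X ({1..n} - T)"
  then obtain x where x: "x \<in> X T" "x \<otimes> g \<in> X ({1..n} - T)" by (auto simp: r_coset_def)
  have "x \<in> carrier G" using x X_subset_carrier[OF assms(1)] by auto
  then have "g = inv x \<otimes> (x \<otimes> g)" using assms by (simp add: m_assoc[symmetric])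
  moreover have "inv x \<in> X T" using subgroup.m_inv_closed[OF subgroup_X[OF assms(1)] x(1)] .
  ultimately show "g \<in> X T <#> X ({1..n} - T)" using x unfolding set_mult_def by blast
qed

text \<open>Intervals from a coset to \<open>{}\<close> carry the whole condition: the increasing
  chain from \<open>X T #> g\<close> supplies a representative in the complement, and such a
  representative yields the chain. Intervals between two cosets always behave well.\<close>

lemma dual_EL_labeling_iff:
  "dual_EL_labeling (bounded_coset_poset G H) (el G H K n) \<longleftrightarrow> group_complemented G H"
proof
  assume EL: "dual_EL_labeling (bounded_coset_poset G H) (el G H K n)"
  have "g \<in> X T <#> X ({1..n} - T)" if T: "T \<subseteq> {1..n}" and g: "g \<in> carrier G" for T g
  proof -
    have "X T #> g \<sqsubseteq>\<^bsub>Q\<^esub> {}" unfolding le_Q by simp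
    then obtain c where c: "maximal_chain_between Q (X T #> g) {} c"
      "sorted_wrt (<) (label_sequence lab c)"
      using EL coset_in_Q[OF T g] empty_in_Q
      unfolding dual_EL_labeling_def EL_labeling_def by blast
    then obtain h "is" where h: "h \<in> X T #> g" and "is": "distinct is" "set is = T"
      "c = coset_chain h T is @ [{}]"
      unfolding maximal_chain_empty_iff[OF T g] by blast
    have "h \<in> carrier G" using h coset_subset_carrier[OF T g] by blast
    then have "h \<in> X ({1..n} - T)" using increasing_chain_empty(1)[OF T _ "is"(1,2)] c(2) "is"(3) by simp
    then show ?thesis using mem_set_mult_complement_iff[OF T g] h by blast
  qed
  moreover have "X T <#> X ({1..n} - T) \<subseteq> carrier G" if "T \<subseteq> {1..n}" for T
    using that X_subset_carrier by (intro setmult_subset_G) auto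
  ultimately show "group_complemented G H" unfolding group_complemented_iff by blast
next
  assume gc: "group_complemented G H"
  have "\<exists>c. maximal_chain_between Q x y c \<and> sorted_wrt (<) (label_sequence lab c) \<and>
      (\<forall>d. maximal_chain_between Q x y d \<and> d \<noteq> c \<longrightarrow>
        \<not> sorted_wrt (<) (label_sequence lab d) \<and>
        (label_sequence lab c, label_sequence lab d) \<in> lexord {(a, b). a < b})"
    if x: "x \<in> carrier Q" and y: "y \<in> carrier Q" and xy: "x \<sqsubseteq>\<^bsub>Q\<^esub> y" for x y
    using y
  proof (cases rule: Q_cases)
    case y: 1
    show ?thesis using x
    proof (cases rule: Q_cases)
      case 1
      show ?thesis
        unfolding y 1 maximal_chain_empty_empty_iff by (intro exI[of _ "[{}]"]) simp
    next
      case (2 T g)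
      \<comment> \<open>Trades \<open>g\<close> for a representative in the complement, as
        \<open>EL_empty_interval\<close> requires.\<close>
      have "g \<in> X T <#> X ({1..n} - T)" using gc 2 unfolding group_complemented_iff by blast
      then obtain h where h: "h \<in> X T #> g" "h \<in> X ({1..n} - T)"
        using mem_set_mult_complement_iff[OF 2(1,2)] by blast
      have "x = X T #> h" using 2 coset_repr h by simp
      moreover have "h \<in> carrier G" using h coset_subset_carrier[OF 2(1,2)] by blast
      ultimately show ?thesis using EL_empty_interval[OF 2(1) _ h(2)] y by simp
    qed
  next
    case y: (2 S g)
    \<comment> \<open>The representative of the smaller coset serves for both.\<close>
    have gx: "g \<in> x" using xy y coset_self unfolding le_Q by blast
    show ?thesis using x
    proof (cases rule: Q_cases)
      case 1
      then show ?thesis using gx by simp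
    next
      case (2 T h)
      then have xg: "x = X T #> g" using gx coset_repr by simp
      have "S \<subseteq> T"
        using xy coset_subset_iff[OF y(1) 2(1) y(2) y(2)] unfolding le_Q y(3) xg by blast
      then show ?thesis using EL_coset_interval[OF _ 2(1) y(2)] y(3) xg by simp
    qed
  qed
  then show "dual_EL_labeling (bounded_coset_poset G H) (el G H K n)"
    unfolding dual_EL_labeling_def EL_labeling_def using graded_poset_Q by blast
qed

end

section \<open>Coordinates from a Boolean isomorphism\<close>

text \<open>The given isomorphism \<open>f\<close> goes to the subsets of some \<open>S\<close> with
  no link to the enumeration \<open>K\<close>. Atoms go to singletons, so \<open>K\<close> induces a
  bijection \<open>e\<close> from \<open>{1..n}\<close> to \<open>S\<close>, and \<open>X T\<close>
  is the preimage under \<open>f\<close> of the image of \<open>T\<close> under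
  \<open>e\<close>.\<close>

lemma boolean_subgroup_interval_exists:
  fixes G :: "('a, 'b) monoid_scheme"
  assumes "group G" "finite (carrier G)" "subgroup H G"
    and "boolean_lattice (subgroup_interval G H)"
    and "bij_betw K {1..n} (atoms_of_interval G H)"
  shows "\<exists>X. boolean_subgroup_interval G H K n X"
proof -
  let ?L = "subgroup_interval G H"
  obtain S :: "nat set" and f where f: "bij_betw f (carrier ?L) (Pow S)"
    and mono: "\<And>U V. U \<in> carrier ?L \<Longrightarrow> V \<in> carrier ?L \<Longrightarrow> U \<subseteq> V \<longleftrightarrow> f U \<subseteq> f V"
    using assms(4) unfolding boolean_lattice_def order_isomorphic_def
    by (auto simp: subgroup_interval_def)
  define \<phi> where "\<phi> = inv_into (carrier ?L) f"
  have \<phi>: "\<phi> A \<in> carrier ?L" "f (\<phi> A) = A" if "A \<subseteq> S" for A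
    using that f unfolding \<phi>_def by (auto simp: bij_betw_def inv_into_into f_inv_into_f)
  have \<phi>f: "\<phi> (f U) = U" if "U \<in> carrier ?L" for U
    using that f unfolding \<phi>_def by (simp add: bij_betw_def)
  have fS: "f U \<subseteq> S" if "U \<in> carrier ?L" for U
    using that f by (auto simp: bij_betw_def)
  have carrier: "U \<in> carrier ?L \<longleftrightarrow> subgroup U G \<and> H \<subseteq> U" for U
    by (simp add: subgroup_interval_def)
  have H: "H \<in> carrier ?L" using assms(3) carrier by simp
  \<comment> \<open>\<open>H\<close> is the least member of the interval and is therefore sent to
    the empty set.\<close>
  have "f H \<subseteq> f (\<phi> {})" using mono[OF H \<phi>(1)] \<phi>(1)[of "{}"] carrier by simp
  then have fH: "f H = {}" using \<phi>(2)[of "{}"] by simp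
  have lless: "U \<sqsubset>\<^bsub>?L\<^esub> V \<longleftrightarrow> U \<subset> V" for U V
    by (auto simp: subgroup_interval_def lless_def)
  \<comment> \<open>For \<open>s\<close> in \<open>f U\<close>, the preimage of \<open>{s}\<close>
    lies strictly above \<open>H\<close> and below the atom \<open>U\<close>, so it is
    \<open>U\<close>.\<close>
  have atomD: "\<exists>s\<in>S. f U = {s}" if "U \<in> atoms_of_interval G H" for U
  proof -
    have U: "covers ?L H U" using that by (simp add: atoms_of_interval_def)
    then have UL: "U \<in> carrier ?L" and HU: "H \<subset> U" using coversD(2,3)[OF U] lless by simp_all
    then have "f U \<noteq> {}" using \<phi>f[OF UL] \<phi>f[OF H] fH by auto
    then obtain s where s: "s \<in> f U" by auto
    then have sS: "{s} \<subseteq> S" using fS[OF UL] by auto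
    have "\<phi> {s} \<subseteq> U" using mono[OF \<phi>(1)[OF sS] UL] \<phi>(2)[OF sS] s by simp
    moreover have "H \<subseteq> \<phi> {s}" using \<phi>(1)[OF sS] carrier by simp
    moreover have "H \<noteq> \<phi> {s}" using \<phi>(2)[OF sS] fH by auto
    ultimately have "\<phi> {s} = U" using coversD(4)[OF U \<phi>(1)[OF sS]] unfolding lless by blast
    then show ?thesis using \<phi>(2)[OF sS] sS by auto
  qed
  have atomI: "\<phi> {s} \<in> atoms_of_interval G H" if "s \<in> S" for s
  proof -
    have sS: "{s} \<subseteq> S" using that by simp
    have no: "\<not> (Z \<in> carrier ?L \<and> H \<subset> Z \<and> Z \<subset> \<phi> {s})" for Z
    proof
      assume "Z \<in> carrier ?L \<and> H \<subset> Z \<and> Z \<subset> \<phi> {s}"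
      then have Z: "Z \<in> carrier ?L" "H \<subset> Z" "Z \<subset> \<phi> {s}" by simp_all
      have "f Z \<subseteq> {s}" using mono[OF Z(1) \<phi>(1)[OF sS]] \<phi>(2)[OF sS] psubset_imp_subset[OF Z(3)] by simp
      then have "f Z = {} \<or> f Z = {s}" by auto
      then have "Z = H \<or> Z = \<phi> {s}" using \<phi>f[OF Z(1)] \<phi>f[OF H] fH by auto
      then show False using Z by auto
    qed
    have "H \<subset> \<phi> {s}" using \<phi>[OF sS] carrier[of "\<phi> {s}"] fH by auto
    then show ?thesis
      using H \<phi>(1)[OF sS] no by (simp add: atoms_of_interval_def covers_def lless)
  qed
  have K: "K i \<in> atoms_of_interval G H" if "i \<in> {1..n}" for i
    using that assms(5) by (auto simp: bij_betw_def)
  have KL: "K i \<in> carrier ?L" if "i \<in> {1..n}" for i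
    using K[OF that] coversD(2)[of ?L H "K i"] by (simp add: atoms_of_interval_def)
  define e where "e i = the_elem (f (K i))" for i
  have e: "f (K i) = {e i}" "e i \<in> S" if i: "i \<in> {1..n}" for i
  proof -
    obtain s where s: "s \<in> S" "f (K i) = {s}" using atomD[OF K[OF i]] by blast
    then have "e i = s" unfolding e_def by simp
    then show "f (K i) = {e i}" "e i \<in> S" using s by simp_all
  qed
  have inj: "inj_on e {1..n}"
  proof (rule inj_onI)
    fix i j assume ij: "i \<in> {1..n}" "j \<in> {1..n}" "e i = e j"
    then have "f (K i) = f (K j)" by (simp only: e(1))
    then have "K i = K j" by (rule inj_onD[OF bij_betw_imp_inj_on[OF f]]) (intro KL ij)+
    then show "i = j" by (rule inj_onD[OF bij_betw_imp_inj_on[OF assms(5)]]) (intro ij)+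
  qed
  \<comment> \<open>Onto, because every singleton comes from an atom and \<open>K\<close> enumerates
    all atoms.\<close>
  have img: "e ` {1..n} = S"
  proof (intro subset_antisym subsetI)
    show "s \<in> S" if "s \<in> e ` {1..n}" for s using that e(2) by blast
  next
    fix s assume "s \<in> S"
    then obtain i where i: "i \<in> {1..n}" "K i = \<phi> {s}"
      using atomI[OF \<open>s \<in> S\<close>] bij_betw_imp_surj_on[OF assms(5)] by (metis imageE)
    then have "{e i} = {s}" using e(1)[OF i(1)] \<phi>(2)[of "{s}"] \<open>s \<in> S\<close> by simp
    then show "s \<in> e ` {1..n}" using i(1) by blast
  qed
  have eS: "e ` T \<subseteq> S" if "T \<subseteq> {1..n}" for T
    using that img by blast
  have "boolean_subgroup_interval G H K n (\<lambda>T. \<phi> (e ` T))"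
  proof (intro boolean_subgroup_interval.intro boolean_subgroup_interval_axioms.intro)
    show "subgroup (\<phi> (e ` T)) G" if "T \<subseteq> {1..n}" for T
      using \<phi>(1)[OF eS[OF that]] carrier by simp
    show "\<phi> (e ` T) \<subseteq> \<phi> (e ` U) \<longleftrightarrow> T \<subseteq> U" if "T \<subseteq> {1..n}" "U \<subseteq> {1..n}" for T U
    proof -
      have "\<phi> (e ` T) \<subseteq> \<phi> (e ` U) \<longleftrightarrow> e ` T \<subseteq> e ` U"
        using mono \<phi> eS that by simp
      also have "\<dots> \<longleftrightarrow> T \<subseteq> U"
        using inj that unfolding inj_on_def by (blast dest: subsetD)
      finally show ?thesis .
    qed
    show "\<exists>T\<subseteq>{1..n}. U = \<phi> (e ` T)" if "subgroup U G" "H \<subseteq> U" for U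
    proof -
      have U: "U \<in> carrier ?L" using that carrier by simp
      then obtain T where "T \<subseteq> {1..n}" "f U = e ` T"
        using fS[OF U] img by (metis subset_imageE)
      then show ?thesis using \<phi>f[OF U] by auto
    qed
    show "\<phi> (e ` {}) = H" using \<phi>f[OF H] fH by simp
    show "\<phi> (e ` {i}) = K i" if "i \<in> {1..n}" for i
      using \<phi>f[OF KL[OF that]] e(1)[OF that] by simp
  qed (use assms in auto)
  then show ?thesis by blast
qed

theorem theorem4p11:
  fixes G :: "('a, 'b) monoid_scheme"
    and H :: "'a set"
    and K :: "nat \<Rightarrow> 'a set"
    and n :: nat
  assumes "group G"
    and "finite (carrier G)"
    and "subgroup H G"
    and "boolean_lattice (subgroup_interval G H)"
    and "bij_betw K {1..n} (atoms_of_interval G H)"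
  shows "dual_EL_labeling (bounded_coset_poset G H) (el G H K n) \<longleftrightarrow> group_complemented G H"
  using boolean_subgroup_interval_exists[OF assms] boolean_subgroup_interval.dual_EL_labeling_iff
  by blast

end
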